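(* There is a tall ideal $\mathcal{I}$ on $\mathbb{N}$ which is a $\mathbf{\Pi}^1_2$ subset of $2^{\mathbb{N}}$ such that for every $x\in\mathcal{I}^+$ and every $\mathcal{F}\subseteq[\mathbb{N}]^{<\omega}$ there is $y\subseteq x$ with $y\in hom(\mathcal{F})\cap\mathcal{I}^+$. In particular, $\mathcal{I}$ does not contain any closed, hereditary, tall subset of $2^{\mathbb{N}}$.
   Context: Subsets of $\mathbb{N}$ are identified with elements of $2^{\mathbb{N}}$. An ideal on $\mathbb{N}$ is a family $\mathcal{I}\subseteq 2^{\mathbb{N}}$ that is hereditary and closed under finite unions; $\mathcal{I}^+=2^{\mathbb{N}}\setminus\mathcal{I}$. A family $\mathcal{C}$ is tall if every infinite $x\subseteq\mathbb{N}$ has an infinite subset in $\mathcal{C}$; it is hereditary if it is closed under taking subsets. For finite $s$ and $t\subseteq\mathbb{N}$, $s\sqsubseteq t$ means $s=t\cap\{0,\dots,n\}$ for some $n$. For $\mathcal{F}\subseteq[\mathbb{N}]^{<\omega}$, $hom(\mathcal{F})$ is the set of infinite $y\subseteq\mathbb{N}$ such that either for every infinite $z\subseteq y$ there is $s\in\mathcal{F}$ with $s\sqsubseteq z$, or no finite subset of $y$ belongs to $\mathcal{F}$. *)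

theory Defs
  imports "HOL-Analysis.Analysis"
begin

text \<open>Boldface projective classes on a topological space, with witnesses from
the Baire space nat => nat (product topology, nat discrete).\<close>

definition Sigma11 :: "'a::topological_space set \<Rightarrow> bool" where
  "Sigma11 A \<longleftrightarrow> (\<exists>C :: ('a \<times> (nat \<Rightarrow> nat)) set. closed C \<and> A = fst ` C)"

definition Pi11 :: "'a::topological_space set \<Rightarrow> bool" where
  "Pi11 A \<longleftrightarrow> Sigma11 (- A)"

definition Sigma12 :: "'a::topological_space set \<Rightarrow> bool" where
  "Sigma12 A \<longleftrightarrow> (\<exists>B :: ('a \<times> (nat \<Rightarrow> nat)) set. Pi11 B \<and> A = fst ` B)"

definition Pi12 :: "'a::topological_space set \<Rightarrow> bool" where
  "Pi12 A \<longleftrightarrow> Sigma12 (- A)"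

definition charf :: "nat set \<Rightarrow> (nat \<Rightarrow> bool)" where
  "charf x = (\<lambda>n. n \<in> x)"

definition Pi12_family :: "nat set set \<Rightarrow> bool" where
  "Pi12_family I \<longleftrightarrow> Pi12 (charf ` I)"

definition closed_family :: "nat set set \<Rightarrow> bool" where
  "closed_family C \<longleftrightarrow> closed (charf ` C)"

definition hereditary :: "nat set set \<Rightarrow> bool" where
  "hereditary C \<longleftrightarrow> (\<forall>x y. x \<in> C \<longrightarrow> y \<subseteq> x \<longrightarrow> y \<in> C)"

definition is_ideal :: "nat set set \<Rightarrow> bool" where
  "is_ideal I \<longleftrightarrow> hereditary I \<and> (\<forall>x y. x \<in> I \<longrightarrow> y \<in> I \<longrightarrow> x \<union> y \<in> I)"

definition tall :: "nat set set \<Rightarrow> bool" where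
  "tall C \<longleftrightarrow> (\<forall>x. infinite x \<longrightarrow> (\<exists>y. y \<subseteq> x \<and> infinite y \<and> y \<in> C))"

definition initial_seg :: "nat set \<Rightarrow> nat set \<Rightarrow> bool" where
  "initial_seg s t \<longleftrightarrow> (\<exists>n. s = t \<inter> {0..n})"

definition hom :: "nat set set \<Rightarrow> nat set set" where
  "hom F = {y. infinite y \<and>
     ((\<forall>z. z \<subseteq> y \<longrightarrow> infinite z \<longrightarrow> (\<exists>s\<in>F. initial_seg s z))
      \<or> (\<forall>s. s \<subseteq> y \<longrightarrow> finite s \<longrightarrow> s \<notin> F))}"

end

theory Submission
  imports Defs
begin

text \<open>For infinite A and a family F of finite sets, Galvin's lemma gives homogeneous subsets of
A, and they can be described by closed conditions on increasing enumerations, so there is a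
lexicographically least one and its choice is Pi-1-1. Starting from the positive integers, iterate:
given a set g already chosen, label it by the nodes of the binary tree, restrict to the branch that
codes F, and choose inside this branch the least set homogeneous for F. The ideal consists of the
sets that contain none of the generators so obtained; this is Pi-1-2, and below every generator
there is one homogeneous for any given F. Applied to singletons, this homogeneity yields closure
under unions. Sets chosen along distinct branches are almost disjoint, so an antichain of the tree
labelling g contains no generator, and the ideal is tall. Finally, a closed hereditary
tall C inside the ideal is refuted by a positive set homogeneous for the finite sets outside C.\<close>

section \<open>Galvin's lemma\<close>

text \<open>Unlike for \<open>initial_seg\<close>, the empty set is always a segment. For finite s
  and t without 0 the two notions agree, which is why the generators below avoid 0.\<close>

definition iseg :: "nat set \<Rightarrow> nat set \<Rightarrow> bool" where
  "iseg s t \<longleftrightarrow> s \<subseteq> t \<and> (\<forall>x\<in>t - s. \<forall>y\<in>s. y < x)"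

definition beyond :: "nat set \<Rightarrow> nat set \<Rightarrow> nat set" where
  "beyond A s = {n \<in> A. \<forall>x\<in>s. x < n}"

lemma beyond_subset: "beyond A s \<subseteq> A"
  by (auto simp: beyond_def)

lemma beyond_mono: "A \<subseteq> B \<Longrightarrow> beyond A s \<subseteq> beyond B s"
  by (auto simp: beyond_def)

lemma beyond_idem [simp]: "beyond (beyond A s) s = beyond A s"
  by (auto simp: beyond_def)

lemma infinite_beyond:
  assumes "infinite A" "finite s"
  shows "infinite (beyond A s)"
proof -
  obtain m where m: "\<forall>x\<in>s. x < m"
    using assms(2) finite_nat_set_iff_bounded by blast
  have "A \<subseteq> beyond A s \<union> {..m}"
    using m by (force simp: beyond_def)
  then show ?thesis
    using assms(1) finite_subset by blast
qed

lemma iseg_Un_beyond: "z \<subseteq> beyond A s \<Longrightarrow> iseg s (s \<union> z)"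
  by (auto simp: iseg_def beyond_def)

lemma iseg_trans: "iseg r s \<Longrightarrow> iseg s t \<Longrightarrow> iseg r t"
  unfolding iseg_def by blast

lemma iseg_linear:
  assumes "iseg r t" "iseg s t"
  shows "iseg r s \<or> iseg s r"
proof -
  have "False" if "x \<in> r" "x \<notin> s" "y \<in> s" "y \<notin> r" for x y
  proof -
    have "x < y" "y < x"
      using that assms by (auto simp: iseg_def)
    then show False by simp
  qed
  then have "r \<subseteq> s \<or> s \<subseteq> r"
    by blast
  then show ?thesis
    using assms by (auto simp: iseg_def)
qed

text \<open>Diagonalisation: in a decreasing chain B, the set \<open>B (Suc n)\<close> satisfies P s
  for the finitely many s below the minimum of \<open>B n\<close>. The minima form y, and the part
  of y beyond a finite s with maximum \<open>a n\<close> lies in \<open>B (Suc n)\<close>, so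
  \<open>mono\<close> applies.\<close>

lemma fusion:
  fixes A :: "nat set"
  assumes A: "infinite A"
    and dense: "\<And>s B. finite s \<Longrightarrow> infinite B \<Longrightarrow> B \<subseteq> A \<Longrightarrow> \<exists>B'\<subseteq>B. infinite B' \<and> P s B'"
    and mono: "\<And>s B B'. P s B \<Longrightarrow> B' \<subseteq> B \<Longrightarrow> infinite B' \<Longrightarrow> P s B'"
  shows "\<exists>y\<subseteq>A. infinite y \<and> (\<forall>s\<subseteq>y. finite s \<longrightarrow> P s (beyond y s))"
proof -
  have dense': "\<exists>B'\<subseteq>B. infinite B' \<and> (\<forall>s\<in>S. P s B')"
    if "finite S" "\<forall>s\<in>S. finite s" "infinite B" "B \<subseteq> A" for S B
    using that
  proof (induction S rule: finite_induct)
    case empty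
    then show ?case by blast
  next
    case (insert s S)
    then obtain B' where B': "B' \<subseteq> B" "infinite B'" "\<forall>s\<in>S. P s B'"
      by auto
    then obtain B'' where "B'' \<subseteq> B'" "infinite B''" "P s B''"
      using dense[of s B'] insert.prems by auto
    then show ?case
      using B' mono by (intro exI[of _ B'']) blast
  qed
  define least where "least = (\<lambda>B :: nat set. LEAST n. n \<in> B)"
  have least_in: "least B \<in> B" if "infinite B" for B
    unfolding least_def using that by (metis LeastI ex_in_conv finite.emptyI)
  \<comment> \<open>The clause for n = 0 takes care of the empty s, which has no maximum.\<close>
  have "\<exists>B. \<forall>n. (infinite (B n) \<and> B n \<subseteq> A \<and> (n = 0 \<longrightarrow> P {} (B n))) \<and>
     (B (Suc n) \<subseteq> B n \<inter> {least (B n)<..} \<and> (\<forall>s\<in>Pow {..least (B n)}. P s (B (Suc n))))"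
  proof (rule dependent_nat_choice)
    show "\<exists>B. infinite B \<and> B \<subseteq> A \<and> (0 = (0::nat) \<longrightarrow> P {} B)"
      using dense[of "{}" A] A by auto
  next
    fix B :: "nat set" and n :: nat
    assume B: "infinite B \<and> B \<subseteq> A \<and> (n = 0 \<longrightarrow> P {} B)"
    have "infinite (B \<inter> {least B<..})"
      using infinite_beyond[of B "{least B}"] B by (auto simp: beyond_def Int_def)
    then obtain B' where "B' \<subseteq> B \<inter> {least B<..}" "infinite B'" "\<forall>s\<in>Pow {..least B}. P s B'"
      using dense'[of "Pow {..least B}" "B \<inter> {least B<..}"] B
      by (metis (no_types, lifting) Pow_iff finite_Pow_iff finite_atMost finite_subset le_infI1)
    then show "\<exists>B'. (infinite B' \<and> B' \<subseteq> A \<and> (Suc n = 0 \<longrightarrow> P {} B')) \<and>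
      (B' \<subseteq> B \<inter> {least B<..} \<and> (\<forall>s\<in>Pow {..least B}. P s B'))"
      using B by blast
  qed
  then obtain B where B_all: "\<forall>n. (infinite (B n) \<and> B n \<subseteq> A \<and> (n = 0 \<longrightarrow> P {} (B n))) \<and>
     (B (Suc n) \<subseteq> B n \<inter> {least (B n)<..} \<and> (\<forall>s\<in>Pow {..least (B n)}. P s (B (Suc n))))"
    by (elim exE)
  have B: "infinite (B n)" "B n \<subseteq> A" "P {} (B 0)"
    and B_Suc: "B (Suc n) \<subseteq> B n \<inter> {least (B n)<..}"
    and B_P: "s \<subseteq> {..least (B n)} \<Longrightarrow> P s (B (Suc n))" for n s
    using B_all[rule_format, of n] B_all[rule_format, of 0] by auto
  have B_anti: "B n \<subseteq> B m" if "m \<le> n" for m n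
  proof (rule lift_Suc_antimono_le[OF _ that])
    show "B (Suc i) \<subseteq> B i" for i
      using B_Suc[of i] by simp
  qed
  define a where "a n = least (B n)" for n
  have a_in: "a n \<in> B m" if "m \<le> n" for m n
    using least_in[OF B(1)] B_anti[OF that] unfolding a_def by blast
  have "a n < a (Suc n)" for n
    using a_in[of "Suc n" "Suc n"] B_Suc[of n] unfolding a_def by auto
  then have mono_a: "strict_mono a"
    by (simp add: strict_mono_Suc_iff)
  have inf: "infinite (range a)"
    using mono_a finite_imageD strict_mono_imp_inj_on by blast
  have "P s (beyond (range a) s)" if s: "s \<subseteq> range a" "finite s" for s
  proof (cases "s = {}")
    case True
    have "beyond (range a) s \<subseteq> B 0"
      using a_in by (auto simp: beyond_def)
    then show ?thesis
      using mono[OF B(3)] infinite_beyond[OF inf s(2)] True by blast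
  next
    case False
    then obtain n where n: "Max s = a n"
      using s Max_in by blast
    have "s \<subseteq> {..a n}"
      using n s(2) Max_ge by (metis atMost_iff subsetI)
    then have "P s (B (Suc n))"
      using B_P unfolding a_def by blast
    moreover have "beyond (range a) s \<subseteq> B (Suc n)"
    proof
      fix x assume "x \<in> beyond (range a) s"
      then obtain m where m: "x = a m" "a n < a m"
        using n Max_in[OF s(2) False] by (auto simp: beyond_def)
      then have "n < m"
        using mono_a strict_mono_less by blast
      then show "x \<in> B (Suc n)"
        using a_in[of "Suc n" m] m by simp
    qed
    ultimately show ?thesis
      using mono infinite_beyond[OF inf s(2)] by blast
  qed
  moreover have "range a \<subseteq> A"
    using a_in[of 0] B(2)[of 0] by auto
  ultimately show ?thesis
    using inf by blast
qed

section \<open>Combinatorial forcing: accepting and rejecting finite sets\<close>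

definition accepts :: "nat set set \<Rightarrow> nat set \<Rightarrow> nat set \<Rightarrow> bool" where
  "accepts F A s \<longleftrightarrow> (\<forall>z\<subseteq>beyond A s. infinite z \<longrightarrow> (\<exists>t\<in>F. iseg t (s \<union> z)))"

definition rejects :: "nat set set \<Rightarrow> nat set \<Rightarrow> nat set \<Rightarrow> bool" where
  "rejects F A s \<longleftrightarrow> (\<forall>B\<subseteq>A. infinite B \<longrightarrow> \<not> accepts F B s)"

lemma accepts_mono: "accepts F A s \<Longrightarrow> B \<subseteq> A \<Longrightarrow> accepts F B s"
  unfolding accepts_def by (meson beyond_mono order_trans)

lemma rejects_mono: "rejects F A s \<Longrightarrow> B \<subseteq> A \<Longrightarrow> rejects F B s"
  unfolding rejects_def by blast

lemma accepts_beyond: "accepts F (beyond A s) s \<longleftrightarrow> accepts F A s"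
  by (simp add: accepts_def)

lemma rejects_beyond:
  assumes "rejects F (beyond A s) s" "finite s"
  shows "rejects F A s"
  unfolding rejects_def
proof (intro allI impI notI)
  fix B assume "B \<subseteq> A" "infinite B" "accepts F B s"
  then have "beyond B s \<subseteq> beyond A s" "infinite (beyond B s)" "accepts F (beyond B s) s"
    using beyond_mono infinite_beyond assms(2) accepts_beyond by auto
  then show False
    using assms(1) unfolding rejects_def by blast
qed

text \<open>If the set C of these n were infinite, C would accept s: an infinite z in C beyond s has
  a least element n, the rest of z lies beyond \<open>insert n s\<close>, and
  \<open>insert n s\<close> is accepted.\<close>

lemma rejects_extend:
  assumes "rejects F A s" "finite s"
  shows "finite {n \<in> beyond A s. accepts F A (insert n s)}"
proof (rule ccontr)
  define C where "C = {n \<in> beyond A s. accepts F A (insert n s)}"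
  assume "infinite {n \<in> beyond A s. accepts F A (insert n s)}"
  then have inf: "infinite C"
    by (simp add: C_def)
  have "accepts F C s"
    unfolding accepts_def
  proof (intro allI impI)
    fix z assume z: "z \<subseteq> beyond C s" "infinite z"
    define n where "n = (LEAST n. n \<in> z)"
    have n: "n \<in> z"
      unfolding n_def using z(2) by (metis LeastI ex_in_conv finite.emptyI)
    have least: "n < m" if "m \<in> z - {n}" for m
      using that Least_le[of "\<lambda>n. n \<in> z" m] unfolding n_def by auto
    have "z - {n} \<subseteq> beyond A (insert n s)" "infinite (z - {n})"
      using z least by (auto simp: beyond_def C_def)
    moreover have "accepts F A (insert n s)"
      using n z by (auto simp: beyond_def C_def)
    ultimately obtain t where "t \<in> F" "iseg t (insert n s \<union> (z - {n}))"
      unfolding accepts_def by blast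
    moreover have "insert n s \<union> (z - {n}) = s \<union> z"
      using n by auto
    ultimately show "\<exists>t\<in>F. iseg t (s \<union> z)"
      by auto
  qed
  moreover have "C \<subseteq> A"
    by (auto simp: beyond_def C_def)
  ultimately show False
    using assms(1) inf unfolding rejects_def by blast
qed

text \<open>A first fusion yields y that decides each of its finite subsets. If y accepts the empty
  set, the first alternative holds. Otherwise a second fusion thins y to w with all finite subsets
  rejected; a member of F among them would be accepted through itself.\<close>

lemma Galvin:
  fixes A :: "nat set"
  assumes "infinite A"
  obtains y where "y \<subseteq> A" "infinite y"
    "(\<forall>z\<subseteq>y. infinite z \<longrightarrow> (\<exists>s\<in>F. iseg s z)) \<or> (\<forall>s\<subseteq>y. finite s \<longrightarrow> s \<notin> F)"
proof -
  have "\<exists>y\<subseteq>A. infinite y \<and>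
     (\<forall>s\<subseteq>y. finite s \<longrightarrow> accepts F (beyond y s) s \<or> rejects F (beyond y s) s)"
  proof (rule fusion[OF assms])
    show "\<exists>B'\<subseteq>B. infinite B' \<and> (accepts F B' s \<or> rejects F B' s)" if "infinite B" for s B
      using that unfolding rejects_def by blast
    show "accepts F B' s \<or> rejects F B' s" if "accepts F B s \<or> rejects F B s" "B' \<subseteq> B" for s B B'
      using that accepts_mono[of F B s B'] rejects_mono[of F B s B'] by blast
  qed
  then obtain y where y: "y \<subseteq> A" "infinite y"
    and decides: "\<And>s. s \<subseteq> y \<Longrightarrow> finite s \<Longrightarrow> accepts F y s \<or> rejects F y s"
    by (elim exE conjE) (simp add: accepts_beyond, metis rejects_beyond)
  show ?thesis
  proof (cases "accepts F y {}")
    case True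
    then have "\<forall>z\<subseteq>y. infinite z \<longrightarrow> (\<exists>s\<in>F. iseg s z)"
      by (simp add: accepts_def beyond_def)
    then show ?thesis
      using that y by blast
  next
    case False
    then have rej0: "rejects F y {}"
      using decides[of "{}"] by simp
    \<comment> \<open>Rejection is measured by the fixed y while B shrinks, so the monotonicity that
      \<open>fusion\<close> asks for is immediate.\<close>
    let ?P = "\<lambda>s B :: nat set. s \<subseteq> y \<and> rejects F y s \<longrightarrow> (\<forall>n\<in>beyond B s. rejects F y (insert n s))"
    have "\<exists>w\<subseteq>y. infinite w \<and> (\<forall>s\<subseteq>w. finite s \<longrightarrow> ?P s (beyond w s))"
    proof (rule fusion[OF y(2)])
      fix s B :: "nat set"
      assume s: "finite s" and B: "infinite B" "B \<subseteq> y"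
      show "\<exists>B'\<subseteq>B. infinite B' \<and> ?P s B'"
      proof (cases "s \<subseteq> y \<and> rejects F y s")
        case True
        let ?B' = "B - {n \<in> beyond y s. accepts F y (insert n s)}"
        have "infinite ?B'"
          using rejects_extend[of F y s] True s B by (simp add: Diff_infinite_finite)
        moreover have "rejects F y (insert n s)" if n: "n \<in> beyond ?B' s" for n
        proof -
          have "n \<in> beyond y s" "\<not> accepts F y (insert n s)"
            using n B by (auto simp: beyond_def)
          then show ?thesis
            using decides[of "insert n s"] True s by (auto simp: beyond_def)
        qed
        ultimately show ?thesis
          by (intro exI[of _ ?B']) auto
      qed (use B in auto)
    qed (auto simp: beyond_def)
    then obtain w where w: "w \<subseteq> y" "infinite w"
      and ext: "\<And>s. s \<subseteq> w \<Longrightarrow> finite s \<Longrightarrow> ?P s (beyond w s)"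
      by blast
    have rej: "rejects F y s" if "finite s" "s \<subseteq> w" for s
      using that
    proof (induction s rule: finite_linorder_max_induct)
      case empty
      show ?case by (rule rej0)
    next
      case (insert n s)
      then have "n \<in> beyond w s" "s \<subseteq> w" "rejects F y s"
        by (auto simp: beyond_def)
      moreover from this have "\<forall>n\<in>beyond w s. rejects F y (insert n s)"
        using ext[of s] insert.hyps w(1) by auto
      ultimately show ?case
        by blast
    qed
    have "s \<notin> F" if s: "s \<subseteq> w" "finite s" for s
    proof
      assume "s \<in> F"
      then have "accepts F y s"
        unfolding accepts_def by (meson iseg_Un_beyond)
      then show False
        using rej[OF s(2,1)] y(2) unfolding rejects_def by blast
    qed
    then show ?thesis
      using that[of w] w y(1) by blast
  qed
qed

section \<open>Lexicographically least homogeneous sets\<close>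

text \<open>The front of F: infinite sets are cut off as soon as the cut contains a member of F as a
  subset, which need not be a segment.\<close>

definition bar :: "nat set set \<Rightarrow> nat set set" where
  "bar F = {t. finite t \<and> (\<exists>s\<in>F. s \<subseteq> t) \<and> (\<forall>r. iseg r t \<and> r \<noteq> t \<longrightarrow> (\<forall>s\<in>F. \<not> s \<subseteq> r))}"

definition good :: "nat set set \<Rightarrow> nat \<Rightarrow> nat set \<Rightarrow> bool" where
  "good F m t \<longleftrightarrow> (if m = 0 then t \<notin> F else t \<in> bar F \<longrightarrow> (\<exists>s\<in>F. iseg s t))"

text \<open>The value at 0 is a mode: in mode 0 no finite subset of the enumerated set belongs
to F, in mode 1 the set is homogeneous relative to the front of F. Both conditions are closed,
and comparing modes first makes the lexicographically least element prefer mode 0; mode 1 is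
then used only where every infinite subset of A has a finite subset in F, and there it gives
the other alternative of Galvin's lemma.\<close>

definition homs :: "nat set \<Rightarrow> nat set set \<Rightarrow> (nat \<Rightarrow> nat) set" where
  "homs A F = {k. k 0 \<le> 1 \<and> strict_mono (k \<circ> Suc) \<and> range (k \<circ> Suc) \<subseteq> A \<and>
     (\<forall>t. finite t \<longrightarrow> t \<subseteq> range (k \<circ> Suc) \<longrightarrow> good F (k 0) t)}"

text \<open>Cut z at the least n for which a member of F is contained in z below n. A proper segment
  of this cut lies below some x < n, so minimality applies to it.\<close>

lemma iseg_finite_cut:
  assumes "infinite z" "s \<in> F" "finite s" "s \<subseteq> z"
  obtains t where "t \<in> bar F" "iseg t z" "finite t"
proof -
  define P where "P n \<longleftrightarrow> (\<exists>s\<in>F. s \<subseteq> z \<inter> {..<n})" for n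
  define n where "n = (LEAST n. P n)"
  obtain m where "\<forall>x\<in>s. x < m"
    using assms(3) finite_nat_set_iff_bounded by blast
  then have "P m"
    using assms by (auto simp: P_def)
  then have Pn: "P n"
    unfolding n_def by (rule LeastI)
  have "\<not> s \<subseteq> r" if r: "iseg r (z \<inter> {..<n})" "r \<noteq> z \<inter> {..<n}" and s: "s \<in> F" for r s
  proof
    assume "s \<subseteq> r"
    obtain x where x: "x \<in> z \<inter> {..<n} - r"
      using r by (auto simp: iseg_def)
    then have "r \<subseteq> z \<inter> {..<x}"
      using r(1) by (auto simp: iseg_def)
    then have "P x"
      using \<open>s \<subseteq> r\<close> s by (auto simp: P_def)
    then have "n \<le> x"
      unfolding n_def by (rule Least_le)
    then show False
      using x by simp
  qed
  then have "z \<inter> {..<n} \<in> bar F"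
    using Pn by (auto simp: bar_def P_def)
  moreover have "iseg (z \<inter> {..<n}) z"
    by (auto simp: iseg_def)
  ultimately show ?thesis
    using that by auto
qed

lemma case_nat_enumerate_in_homs:
  assumes "infinite z" "z \<subseteq> A" "m \<le> 1" "\<And>t. finite t \<Longrightarrow> t \<subseteq> z \<Longrightarrow> good F m t"
  shows "case_nat m (enumerate z) \<in> homs A F"
proof -
  have "case_nat m (enumerate z) \<circ> Suc = enumerate z"
    by (simp add: fun_eq_iff)
  then show ?thesis
    using assms by (simp add: homs_def range_enumerate strict_mono_enumerate)
qed

text \<open>If some infinite subset of A has no finite subset in F, its enumeration works in mode 0.
  Otherwise Galvin's lemma for \<open>F \<inter> bar F\<close> must end in its first alternative on
  some y, and the enumeration of y works in mode 1.\<close>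

lemma homs_nonempty:
  assumes "infinite A"
  shows "homs A F \<noteq> {}"
proof (cases "\<exists>w\<subseteq>A. infinite w \<and> (\<forall>t\<subseteq>w. finite t \<longrightarrow> t \<notin> F)")
  case True
  then obtain w where "w \<subseteq> A" "infinite w" "\<forall>t\<subseteq>w. finite t \<longrightarrow> t \<notin> F"
    by blast
  then have "case_nat 0 (enumerate w) \<in> homs A F"
    by (intro case_nat_enumerate_in_homs) (auto simp: good_def)
  then show ?thesis
    by blast
next
  case False
  obtain y where y: "y \<subseteq> A" "infinite y"
    and hom: "(\<forall>z\<subseteq>y. infinite z \<longrightarrow> (\<exists>s\<in>F \<inter> bar F. iseg s z)) \<or>
      (\<forall>s\<subseteq>y. finite s \<longrightarrow> s \<notin> F \<inter> bar F)"
    by (rule Galvin[OF assms, of "F \<inter> bar F"])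
  have "\<exists>s. s \<subseteq> y \<and> finite s \<and> s \<in> F"
    using False y by blast
  \<comment> \<open>A member of F of least cardinality lies in the front, since its proper segments
    are smaller; this excludes the second alternative.\<close>
  then obtain s where s: "s \<subseteq> y" "finite s" "s \<in> F"
    and min: "\<And>s'. s' \<subseteq> y \<Longrightarrow> finite s' \<Longrightarrow> s' \<in> F \<Longrightarrow> card s \<le> card s'"
    using ex_has_least_nat[of "\<lambda>s. s \<subseteq> y \<and> finite s \<and> s \<in> F" _ card] by metis
  have "\<not> s' \<subseteq> r" if r: "iseg r s" "r \<noteq> s" and s': "s' \<in> F" for r s'
  proof
    assume sub: "s' \<subseteq> r"
    have "r \<subset> s"
      using r by (auto simp: iseg_def)
    then have "card s' < card s" "s' \<subseteq> y" "finite s'"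
      using s sub psubset_card_mono[of s s'] finite_subset[of s' s] by auto
    then show False
      using min[of s'] s' by simp
  qed
  then have "s \<in> F \<inter> bar F"
    using s by (auto simp: bar_def)
  then have thin: "\<exists>s\<in>F \<inter> bar F. iseg s z" if "z \<subseteq> y" "infinite z" for z
    using hom s that by blast
  have "good F 1 t" if t: "finite t" "t \<subseteq> y" for t
  proof -
    have "\<exists>s\<in>F. iseg s t" if bar: "t \<in> bar F"
    proof -
      \<comment> \<open>Completing t to an infinite set yields a segment s in
        \<open>F \<inter> bar F\<close> comparable with t. Both lie in the front, so t is not a
        proper segment of s.\<close>
      let ?z = "t \<union> beyond y t"
      have "?z \<subseteq> y" "infinite ?z"
        using t y infinite_beyond beyond_subset[of y t] by auto
      then obtain s where s: "s \<in> F" "s \<in> bar F" "iseg s ?z"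
        using thin by blast
      moreover have "iseg t ?z"
        by (rule iseg_Un_beyond[OF order_refl])
      ultimately consider "iseg s t" | "iseg t s"
        using iseg_linear by blast
      then show ?thesis
      proof cases
        case 2
        then have "t = s"
          using s(2) bar unfolding bar_def by blast
        then show ?thesis
          using s(1) by (auto simp: iseg_def)
      qed (use s in blast)
    qed
    then show ?thesis
      by (simp add: good_def)
  qed
  then have "case_nat 1 (enumerate y) \<in> homs A F"
    by (intro case_nat_enumerate_in_homs) (use y in auto)
  then show ?thesis
    by blast
qed

section \<open>Lexicographically least elements of closed sets\<close>

definition lexless :: "(nat \<Rightarrow> nat) \<Rightarrow> (nat \<Rightarrow> nat) \<Rightarrow> bool" where
  "lexless k k' \<longleftrightarrow> (\<exists>n. (\<forall>i<n. k i = k' i) \<and> k n < k' n)"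

definition is_lexmin :: "(nat \<Rightarrow> nat) set \<Rightarrow> (nat \<Rightarrow> nat) \<Rightarrow> bool" where
  "is_lexmin C k \<longleftrightarrow> k \<in> C \<and> (\<forall>k'. k' \<in> C \<longrightarrow> \<not> lexless k' k)"

definition lexmin :: "(nat \<Rightarrow> nat) set \<Rightarrow> nat \<Rightarrow> nat" where
  "lexmin C = (THE k. is_lexmin C k)"

lemma lexless_linear:
  assumes "k \<noteq> k'"
  shows "lexless k k' \<or> lexless k' k"
proof -
  obtain n where n: "k n \<noteq> k' n" "\<And>i. i < n \<Longrightarrow> k i = k' i"
    using assms exists_least_iff[of "\<lambda>n. k n \<noteq> k' n"] by blast
  then have "k n < k' n \<or> k' n < k n"
    by auto
  then show ?thesis
    unfolding lexless_def using n(2) by metis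
qed

lemma is_lexmin_unique: "is_lexmin C k \<Longrightarrow> is_lexmin C k' \<Longrightarrow> k = k'"
  unfolding is_lexmin_def using lexless_linear by blast

text \<open>Greedy choice: \<open>g (Suc n)\<close> keeps the first n values of \<open>g n\<close>
  and minimises the value at n within C. The limit of these functions belongs to C by
  closedness.\<close>

lemma ex_is_lexmin:
  assumes "C \<noteq> {}"
    and closed: "\<And>k. (\<And>n. \<exists>k'\<in>C. \<forall>i<n. k' i = k i) \<Longrightarrow> k \<in> C"
  shows "\<exists>k. is_lexmin C k"
proof -
  have "\<exists>g. \<forall>n. g n \<in> C \<and> ((\<forall>i<n. g (Suc n) i = g n i) \<and>
    (\<forall>k\<in>C. (\<forall>i<n. k i = g n i) \<longrightarrow> g (Suc n) n \<le> k n))"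
  proof (rule dependent_nat_choice)
    show "\<exists>k. k \<in> C"
      using assms(1) by blast
  next
    fix k n assume "k \<in> C"
    then show "\<exists>h. h \<in> C \<and> ((\<forall>i<n. h i = k i) \<and> (\<forall>k'\<in>C. (\<forall>i<n. k' i = k i) \<longrightarrow> h n \<le> k' n))"
      using ex_has_least_nat[of "\<lambda>h. h \<in> C \<and> (\<forall>i<n. h i = k i)" k "\<lambda>h. h n"] by auto
  qed
  then obtain g where g: "\<And>n. g n \<in> C" "\<And>n i. i < n \<Longrightarrow> g (Suc n) i = g n i"
    "\<And>n k. k \<in> C \<Longrightarrow> (\<forall>i<n. k i = g n i) \<Longrightarrow> g (Suc n) n \<le> k n"
    by blast
  define k where "k n = g (Suc n) n" for n
  have agree: "g n i = k i" if "i < n" for i n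
    using that
  proof (induction n)
    case (Suc n)
    then show ?case
      using g(2)[of i n] by (cases "i = n") (auto simp: k_def)
  qed simp
  have "k \<in> C"
    by (rule closed) (use g(1) agree in blast)
  moreover have "\<not> lexless k' k" if k': "k' \<in> C" for k'
  proof
    assume "lexless k' k"
    then obtain n where n: "\<forall>i<n. k' i = k i" "k' n < k n"
      unfolding lexless_def by blast
    then have "\<forall>i<n. k' i = g n i"
      using agree by simp
    then show False
      using g(3)[OF k', of n] n(2) unfolding k_def by simp
  qed
  ultimately show ?thesis
    unfolding is_lexmin_def by blast
qed

text \<open>Each clause of \<open>homs\<close> is tested on finitely many values: a finite t in the
  range of k is the image of finitely many indices, and some member of \<open>homs\<close> agrees
  with k there.\<close>

lemma homs_closed:
  assumes "\<And>n. \<exists>k'\<in>homs A F. \<forall>i<n. k' i = k i"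
  shows "k \<in> homs A F"
proof -
  have approx: "\<exists>k'\<in>homs A F. k' 0 = k 0 \<and> (\<forall>i\<le>n. k' (Suc i) = k (Suc i))" for n
  proof -
    obtain k' where "k' \<in> homs A F" "\<forall>i<Suc (Suc n). k' i = k i"
      using assms by blast
    then show ?thesis
      by (intro bexI[of _ k']) auto
  qed
  have "k 0 \<le> 1"
    using approx[of 0] by (auto simp: homs_def)
  moreover have "k (Suc n) < k (Suc (Suc n)) \<and> k (Suc n) \<in> A" for n
  proof -
    obtain k' where k': "k' \<in> homs A F" "\<forall>i\<le>Suc n. k' (Suc i) = k (Suc i)"
      using approx by blast
    then have "strict_mono (k' \<circ> Suc)" "range (k' \<circ> Suc) \<subseteq> A"
      unfolding homs_def by blast+
    then have "k' (Suc n) < k' (Suc (Suc n))" "k' (Suc n) \<in> A"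
      using strict_monoD[of "k' \<circ> Suc" n "Suc n"] by auto
    then show ?thesis
      using k'(2) by simp
  qed
  moreover have "good F (k 0) t" if t: "finite t" "t \<subseteq> range (k \<circ> Suc)" for t
  proof -
    obtain N where N: "finite N" "t = (k \<circ> Suc) ` N"
      using finite_subset_image[OF t] by blast
    obtain n where n: "\<forall>i\<in>N. i < n"
      using N(1) finite_nat_set_iff_bounded by blast
    obtain k' where k': "k' \<in> homs A F" "k' 0 = k 0" "\<forall>i\<le>n. k' (Suc i) = k (Suc i)"
      using approx by blast
    then have "t = (k' \<circ> Suc) ` N"
      using n N(2) by (auto simp: less_imp_le intro!: image_cong)
    then have "t \<subseteq> range (k' \<circ> Suc)"
      by blast
    then show ?thesis
      using k'(1,2) t(1) unfolding homs_def by (metis (no_types, lifting) mem_Collect_eq)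
  qed
  ultimately show ?thesis
    by (simp add: homs_def strict_mono_Suc_iff image_subset_iff)
qed

lemma is_lexmin_homs:
  assumes "infinite A"
  shows "is_lexmin (homs A F) (lexmin (homs A F))"
proof -
  have "\<exists>!k. is_lexmin (homs A F) k"
    using ex_is_lexmin[OF homs_nonempty[OF assms] homs_closed] is_lexmin_unique by blast
  then show ?thesis
    unfolding lexmin_def by (rule theI')
qed

text \<open>In mode 1 every infinite z in the range has a finite subset in F, since otherwise its
  enumeration in mode 0 would be smaller already at coordinate 0. So z has a segment in the front,
  and \<open>good\<close> puts a member of F at the start of that segment.\<close>

lemma is_lexmin_homs_homogeneous:
  assumes "is_lexmin (homs A F) k"
  shows "(\<forall>z\<subseteq>range (k \<circ> Suc). infinite z \<longrightarrow> (\<exists>s\<in>F. iseg s z)) \<or>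
    (\<forall>s\<subseteq>range (k \<circ> Suc). finite s \<longrightarrow> s \<notin> F)"
proof (cases "k 0 = 0")
  case True
  then show ?thesis
    using assms by (auto simp: is_lexmin_def homs_def good_def)
next
  case False
  have k: "k \<in> homs A F"
    using assms by (simp add: is_lexmin_def)
  have "\<exists>s\<in>F. iseg s z" if z: "z \<subseteq> range (k \<circ> Suc)" "infinite z" for z
  proof -
    have "\<exists>s\<in>F. finite s \<and> s \<subseteq> z"
    proof (rule ccontr)
      assume "\<not> (\<exists>s\<in>F. finite s \<and> s \<subseteq> z)"
      then have "case_nat 0 (enumerate z) \<in> homs A F"
        using z k by (intro case_nat_enumerate_in_homs) (auto simp: good_def homs_def)
      moreover have "lexless (case_nat 0 (enumerate z)) k"
        using False unfolding lexless_def by (intro exI[of _ 0]) auto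
      ultimately show False
        using assms by (auto simp: is_lexmin_def)
    qed
    then obtain t where t: "t \<in> bar F" "iseg t z" "finite t"
      using iseg_finite_cut[OF z(2)] by metis
    then have "good F (k 0) t"
      using k z(1) by (auto simp: homs_def iseg_def)
    then obtain s where "s \<in> F" "iseg s t"
      using False t(1) by (auto simp: good_def)
    then show ?thesis
      using iseg_trans t(2) by blast
  qed
  then show ?thesis
    by blast
qed

section \<open>The generators and the ideal\<close>

text \<open>The codes of the nodes of the binary tree on the branch f; the new element n of the
coded set records the level of the node, so distinct branches share only finitely many nodes.\<close>

definition branch :: "nat set \<Rightarrow> nat \<Rightarrow> nat" where
  "branch f n = set_encode (insert n (f \<inter> {..<n}))"

text \<open>The same f serves as a branch of the tree and as the code of a family, so distinct codes
  are handled along distinct branches.\<close>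

definition family :: "nat set \<Rightarrow> nat set set" where
  "family f = set_decode ` f"

text \<open>The head of the list is the latest choice, so ancestors are suffixes. The value at 0 is
  the mode, as in \<open>homs\<close>; starting from \<open>id\<close> makes the positive integers
  the first generator. The element \<open>(gen c \<circ> Suc) j\<close> carries the label j.\<close>

primrec gen :: "nat set list \<Rightarrow> nat \<Rightarrow> nat" where
  "gen [] = id"
| "gen (f # c) = lexmin (homs ((gen c \<circ> Suc) ` range (branch f)) (family f))"

definition genset :: "nat set list \<Rightarrow> nat set" where
  "genset c = range (gen c \<circ> Suc)"

definition gen_ideal :: "nat set set" where
  "gen_ideal = {x. \<forall>c. \<not> genset c \<subseteq> x}"

lemma branch_eqD:
  assumes "branch f n = branch f' m"
  shows "n = m" "f \<inter> {..<n} = f' \<inter> {..<n}"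
proof -
  have eq: "insert n (f \<inter> {..<n}) = insert m (f' \<inter> {..<m})"
    using assms unfolding branch_def by (subst (asm) set_encode_eq) auto
  have "n \<le> m"
    using eq by (metis Int_iff insert_iff lessThan_iff less_imp_le order_refl)
  moreover have "m \<le> n"
    using eq by (metis Int_iff insert_iff lessThan_iff less_imp_le order_refl)
  ultimately show "n = m"
    by simp
  then show "f \<inter> {..<n} = f' \<inter> {..<n}"
    using eq by (metis Diff_insert_absorb Int_iff lessThan_iff less_irrefl)
qed

lemma infinite_image_branch:
  assumes "strict_mono g"
  shows "infinite (g ` range (branch f))"
proof -
  have "inj (branch f)"
    using branch_eqD(1) by (auto intro: injI)
  moreover have "inj g"
    using assms strict_mono_imp_inj_on by blast
  ultimately have "inj (g \<circ> branch f)"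
    by (simp add: inj_compose)
  then have "infinite (range (g \<circ> branch f))"
    using finite_imageD by blast
  then show ?thesis
    by (simp add: image_comp)
qed

lemma strict_mono_gen: "strict_mono (gen c \<circ> Suc)"
proof (induction c)
  case Nil
  show ?case
    by (simp add: strict_mono_Suc_iff)
next
  case (Cons f c)
  have "gen (f # c) \<in> homs ((gen c \<circ> Suc) ` range (branch f)) (family f)"
    using is_lexmin_homs[OF infinite_image_branch[OF Cons.IH]] by (simp add: is_lexmin_def)
  then show ?case
    unfolding homs_def by blast
qed

lemma is_lexmin_gen:
  "is_lexmin (homs ((gen c \<circ> Suc) ` range (branch f)) (family f)) (gen (f # c))"
  using is_lexmin_homs[OF infinite_image_branch[OF strict_mono_gen]] by simp

lemma inj_gen: "inj (gen c \<circ> Suc)"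
  using strict_mono_gen strict_mono_imp_inj_on by blast

lemma infinite_genset: "infinite (genset c)"
  unfolding genset_def using inj_gen finite_imageD by blast

lemma genset_Cons: "genset (f # c) \<subseteq> (gen c \<circ> Suc) ` range (branch f)"
  using is_lexmin_gen[of c f] unfolding is_lexmin_def homs_def genset_def by blast

lemma genset_append: "genset (c1 @ c) \<subseteq> genset c"
proof (induction c1)
  case (Cons f c1)
  have "genset (f # (c1 @ c)) \<subseteq> genset (c1 @ c)"
    using genset_Cons[of f "c1 @ c"] by (auto simp: genset_def)
  then show ?case
    using Cons.IH by simp
qed simp

lemma zero_notin_genset: "0 \<notin> genset c"
  using genset_append[of c "[]"] by (auto simp: genset_def)

section \<open>Almost disjoint generators and tallness\<close>

lemma finite_branch_Int:
  assumes "f \<noteq> f'"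
  shows "finite (range (branch f) \<inter> range (branch f'))"
proof -
  obtain m where m: "m \<in> f \<longleftrightarrow> m \<notin> f'"
    using assms by blast
  \<comment> \<open>A common node determines f and f' below its level, so the level is at most a
    point m at which they differ.\<close>
  have "range (branch f) \<inter> range (branch f') \<subseteq> branch f ` {..m}"
  proof
    fix x assume "x \<in> range (branch f) \<inter> range (branch f')"
    then obtain n n' where x: "x = branch f n" "branch f n = branch f' n'"
      by auto
    then have "f \<inter> {..<n} = f' \<inter> {..<n}"
      using branch_eqD(2) by blast
    then have "\<not> m < n"
      using m by (metis Int_iff lessThan_iff)
    then show "x \<in> branch f ` {..m}"
      using x(1) by auto
  qed
  then show ?thesis
    using finite_subset by blast
qed

lemma finite_genset_Int:
  assumes "f \<noteq> f'"
  shows "finite (genset (c1 @ f # c) \<inter> genset (c2 @ f' # c))"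
proof -
  have "genset (c1 @ f # c) \<inter> genset (c2 @ f' # c) \<subseteq>
      (gen c \<circ> Suc) ` range (branch f) \<inter> (gen c \<circ> Suc) ` range (branch f')"
    using genset_append[of c1 "f # c"] genset_append[of c2 "f' # c"] genset_Cons by blast
  also have "\<dots> = (gen c \<circ> Suc) ` (range (branch f) \<inter> range (branch f'))"
    by (rule image_Int[OF inj_gen, symmetric])
  finally show ?thesis
    using finite_branch_Int[OF assms] finite_subset by blast
qed

text \<open>Lists are compared from the end, that is, from the earliest choice on.\<close>

lemma suffix_trichotomy:
  "(\<exists>c1. c' = c1 @ c) \<or> (\<exists>c1. c = c1 @ c') \<or>
   (\<exists>c1 c2 f f' d. c = c1 @ f # d \<and> c' = c2 @ f' # d \<and> f \<noteq> f')"
proof (induction c')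
  case (Cons a c')
  then consider c1 where "c' = c1 @ c" | c1 where "c = c1 @ c'"
    | c1 c2 f f' d where "c = c1 @ f # d" "c' = c2 @ f' # d" "f \<noteq> f'"
    by blast
  then show ?case
  proof cases
    case 1
    then have "a # c' = (a # c1) @ c"
      by simp
    then show ?thesis
      by blast
  next
    case 2
    show ?thesis
    proof (cases c1 rule: rev_cases)
      case Nil
      then have "a # c' = [a] @ c"
        using 2 by simp
      then show ?thesis
        by blast
    next
      \<comment> \<open>Here f is the choice made right after c' on the way to c; it is compared
        with a.\<close>
      case (snoc c2 f)
      then have c: "c = c2 @ f # c'"
        using 2 by simp
      show ?thesis
      proof (cases "f = a")
        case False
        moreover have "a # c' = [] @ a # c'"
          by simp
        ultimately show ?thesis
          using c by blast
      qed (use c in blast)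
    qed
  next
    case 3
    then have "a # c' = (a # c2) @ f' # d"
      by simp
    then show ?thesis
      using 3 by blast
  qed
qed simp

text \<open>The code of {n, n+1} is the node of \<open>branch {n}\<close> at level n+1. If it lies
  on the branch of f, then n is the least element of f, so at most one of these nodes does.\<close>

lemma finite_antichain_Int_branch:
  "finite (range (\<lambda>n. set_encode {n, Suc n}) \<inter> range (branch f))"
proof -
  have "n = m" if "set_encode {n, Suc n} \<in> range (branch f)" "set_encode {m, Suc m} \<in> range (branch f)"
    for n m
  proof -
    have *: "f \<inter> {..<Suc i} = {i}" if i: "set_encode {i, Suc i} \<in> range (branch f)" for i
    proof -
      have "set_encode {i, Suc i} = branch {i} (Suc i)"
        by (simp add: branch_def insert_commute)
      then obtain j where "branch {i} (Suc i) = branch f j"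
        using i by auto
      then show ?thesis
        using branch_eqD(2)[of "{i}" "Suc i" f j] by auto
    qed
    have "n \<in> f \<inter> {..<Suc n}" "m \<in> f \<inter> {..<Suc m}"
      using *[OF that(1)] *[OF that(2)] by simp_all
    then have "n \<in> f" "m \<in> f"
      by simp_all
    then show ?thesis
      using *[OF that(1)] *[OF that(2)]
      by (metis Int_iff lessThan_iff less_Suc_eq linorder_neqE_nat singletonD)
  qed
  then have "\<exists>n. range (\<lambda>n. set_encode {n, Suc n}) \<inter> range (branch f) \<subseteq> {set_encode {n, Suc n}}"
    by (cases "\<exists>n. set_encode {n, Suc n} \<in> range (branch f)") blast+
  then show ?thesis
    using finite_subset by blast
qed

text \<open>The part z of \<open>genset c\<close> labelled by the antichain Z contains no generator:
  a proper descendant of c follows one branch and can share only finitely many elements with z, an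
  incomparable generator is almost disjoint from \<open>genset c\<close>, and c and its ancestors
  include \<open>genset c\<close>, which exceeds z.\<close>

lemma tall_gen_ideal: "tall gen_ideal"
  unfolding tall_def
proof (intro allI impI)
  fix x :: "nat set"
  assume x: "infinite x"
  show "\<exists>y\<subseteq>x. infinite y \<and> y \<in> gen_ideal"
  proof (cases "x \<in> gen_ideal")
    case False
    then obtain c where c: "genset c \<subseteq> x"
      by (auto simp: gen_ideal_def)
    define Z where "Z = range (\<lambda>n. set_encode {n, Suc n})"
    define z where "z = (gen c \<circ> Suc) ` Z"
    have "inj (\<lambda>n. set_encode {n, Suc n})"
      by (rule injI) (simp add: set_encode_eq doubleton_eq_iff)
    then have "infinite Z"
      unfolding Z_def using finite_imageD by blast
    then have z_inf: "infinite z"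
      unfolding z_def using inj_gen[of c] finite_imageD inj_on_subset by blast
    have z_sub: "z \<subseteq> genset c"
      by (auto simp: z_def genset_def)
    \<comment> \<open>As 0 codes the empty set, the element of \<open>genset c\<close> with label 0
      is left out of z.\<close>
    have "0 \<notin> Z"
    proof
      assume "0 \<in> Z"
      then obtain n where "set_encode {n, Suc n} = set_encode {}"
        by (auto simp: Z_def)
      then show False
        using set_encode_eq[of "{n, Suc n}" "{}"] by simp
    qed
    then have "(gen c \<circ> Suc) 0 \<notin> z"
      unfolding z_def using inj_gen[of c] by (metis inj_image_mem_iff)
    then have proper: "\<not> genset c \<subseteq> z"
      by (auto simp: genset_def)
    have "\<not> genset c' \<subseteq> z" for c'
    proof
      assume c': "genset c' \<subseteq> z"
      consider c1 where "c' = c1 @ c" | c1 where "c = c1 @ c'"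
        | c1 c2 f f' d where "c = c1 @ f # d" "c' = c2 @ f' # d" "f \<noteq> f'"
        using suffix_trichotomy[of c' c] by blast
      then show False
      proof cases
        case eq: 1
        show False
        proof (cases c1 rule: rev_cases)
          case Nil
          then show False
            using eq c' proper by simp
        next
          case (snoc c2 f)
          then have "genset c' \<subseteq> (gen c \<circ> Suc) ` range (branch f)"
            using genset_append[of c2 "f # c"] genset_Cons[of f c] eq by auto
          then have "genset c' \<subseteq> (gen c \<circ> Suc) ` (Z \<inter> range (branch f))"
            using c' unfolding z_def image_Int[OF inj_gen] by blast
          moreover have "finite (Z \<inter> range (branch f))"
            unfolding Z_def by (rule finite_antichain_Int_branch)
          ultimately show False
            using infinite_genset finite_subset by blast
        qed
      next
        case 2
        then show False
          using genset_append[of c1 c'] c' proper by auto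
      next
        case 3
        then have "finite (genset c \<inter> genset c')"
          using finite_genset_Int by blast
        moreover have "genset c \<inter> genset c' = genset c'"
          using c' z_sub by blast
        ultimately show False
          using infinite_genset by simp
      qed
    qed
    then have "z \<in> gen_ideal"
      by (simp add: gen_ideal_def)
    then show ?thesis
      using z_inf z_sub c by blast
  qed (use x in blast)
qed

section \<open>Homogeneous generators and closure under unions\<close>

lemma genset_homogeneous:
  assumes "\<forall>s\<in>F. finite s"
  obtains c' where "genset c' \<subseteq> genset c"
    "(\<forall>z\<subseteq>genset c'. infinite z \<longrightarrow> (\<exists>s\<in>F. iseg s z)) \<or>
     (\<forall>s\<subseteq>genset c'. finite s \<longrightarrow> s \<notin> F)"
proof -
  have "set_decode (set_encode s) = s" if "s \<in> F" for s
    using assms that by (simp add: set_encode_inverse)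
  then have "family (set_encode ` F) = F"
    by (simp add: family_def image_comp)
  then have "(\<forall>z\<subseteq>genset (set_encode ` F # c). infinite z \<longrightarrow> (\<exists>s\<in>F. iseg s z)) \<or>
     (\<forall>s\<subseteq>genset (set_encode ` F # c). finite s \<longrightarrow> s \<notin> F)"
    using is_lexmin_homs_homogeneous[OF is_lexmin_gen[of c "set_encode ` F"]]
    unfolding genset_def by simp
  then show ?thesis
    using that genset_append[of "[set_encode ` F]" c] by auto
qed

text \<open>A generator inside a union of x and y is refined to one homogeneous for the singletons
  of points of x. The refinement is then included in x, or it misses x and is included in y.\<close>

lemma is_ideal_gen_ideal: "is_ideal gen_ideal"
  unfolding is_ideal_def
proof (intro conjI allI impI)
  show "hereditary gen_ideal"
    by (auto simp: hereditary_def gen_ideal_def)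
next
  fix x y assume xy: "x \<in> gen_ideal" "y \<in> gen_ideal"
  show "x \<union> y \<in> gen_ideal"
  proof (rule ccontr)
    assume "x \<union> y \<notin> gen_ideal"
    then obtain c where c: "genset c \<subseteq> x \<union> y"
      by (auto simp: gen_ideal_def)
    obtain c' where c': "genset c' \<subseteq> genset c" and
      hom: "(\<forall>z\<subseteq>genset c'. infinite z \<longrightarrow> (\<exists>s\<in>(\<lambda>n. {n}) ` x. iseg s z)) \<or>
        (\<forall>s\<subseteq>genset c'. finite s \<longrightarrow> s \<notin> (\<lambda>n. {n}) ` x)"
      by (rule genset_homogeneous[of "(\<lambda>n. {n}) ` x" c]) auto
    from hom have "genset c' \<subseteq> x \<or> genset c' \<subseteq> y"
    proof
      assume all: "\<forall>z\<subseteq>genset c'. infinite z \<longrightarrow> (\<exists>s\<in>(\<lambda>n. {n}) ` x. iseg s z)"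
      have "m \<in> x" if m: "m \<in> genset c'" for m
      proof -
        \<comment> \<open>The only singleton that is a segment of this set is {m}.\<close>
        let ?z = "{m} \<union> beyond (genset c') {m}"
        have "?z \<subseteq> genset c'" "infinite ?z"
          using m beyond_subset[of "genset c'" "{m}"] infinite_beyond[OF infinite_genset[of c'], of "{m}"]
          by auto
        then obtain n where "n \<in> x" "iseg {n} ?z"
          using all by blast
        moreover have "n = m"
        proof (rule ccontr)
          assume "n \<noteq> m"
          then have "n < m" "n \<in> ?z"
            using \<open>iseg {n} ?z\<close> by (auto simp: iseg_def)
          then show False
            by (auto simp: beyond_def)
        qed
        ultimately show ?thesis
          by simp
      qed
      then show ?thesis
        by blast
    next
      assume none: "\<forall>s\<subseteq>genset c'. finite s \<longrightarrow> s \<notin> (\<lambda>n. {n}) ` x"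
      have "m \<notin> x" if "m \<in> genset c'" for m
        using none[rule_format, of "{m}"] that by auto
      then show ?thesis
        using c c' by blast
    qed
    then show False
      using xy by (auto simp: gen_ideal_def)
  qed
qed

text \<open>A nonempty s is z cut at the maximum of s. The empty s is z cut at 0, provided that 0 is
  not in z.\<close>

lemma iseg_imp_initial_seg:
  assumes "iseg s z" "finite s" "0 \<notin> z"
  shows "initial_seg s z"
proof (cases "s = {}")
  case True
  then show ?thesis
    using assms(3) by (auto simp: initial_seg_def intro!: exI[of _ 0])
next
  case False
  have "x \<le> Max s" if "x \<in> s" for x
    using that assms(2) by simp
  moreover have "x \<in> s" if "x \<in> z" "x \<le> Max s" for x
    using that assms(1) Max_in[OF assms(2) False] unfolding iseg_def by (meson DiffI leD)
  ultimately have "s = z \<inter> {0..Max s}"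
    using assms(1) by (auto simp: iseg_def)
  then show ?thesis
    unfolding initial_seg_def by blast
qed

lemma ex_positive_hom:
  assumes "x \<notin> gen_ideal" "\<forall>s\<in>F. finite s"
  shows "\<exists>y\<subseteq>x. y \<in> hom F \<and> y \<notin> gen_ideal"
proof -
  obtain c where c: "genset c \<subseteq> x"
    using assms(1) by (auto simp: gen_ideal_def)
  obtain c' where c': "genset c' \<subseteq> genset c" and
    hom: "(\<forall>z\<subseteq>genset c'. infinite z \<longrightarrow> (\<exists>s\<in>F. iseg s z)) \<or>
      (\<forall>s\<subseteq>genset c'. finite s \<longrightarrow> s \<notin> F)"
    by (rule genset_homogeneous[OF assms(2)])
  have "\<exists>s\<in>F. initial_seg s z" if z: "z \<subseteq> genset c'" and "\<exists>s\<in>F. iseg s z" for z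
    using that assms(2) iseg_imp_initial_seg[of _ z] zero_notin_genset[of c'] by blast
  then have "genset c' \<in> hom F"
    using hom infinite_genset[of c'] unfolding hom_def by blast
  moreover have "genset c' \<notin> gen_ideal"
    by (auto simp: gen_ideal_def)
  ultimately show ?thesis
    using c c' by blast
qed

lemma closed_family_approx:
  assumes "closed_family C" "\<And>n. \<exists>y\<in>C. \<forall>i<n. i \<in> y \<longleftrightarrow> i \<in> x"
  shows "x \<in> C"
proof -
  obtain y where y: "\<And>n. y n \<in> C" "\<And>n i. i < n \<Longrightarrow> i \<in> y n \<longleftrightarrow> i \<in> x"
    using assms(2) by metis
  have "(\<lambda>n. charf (y n) i) \<longlonglongrightarrow> charf x i" for i
  proof (rule tendsto_eventually)
    have "\<forall>n\<ge>Suc i. charf (y n) i = charf x i"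
      using y(2) by (simp add: charf_def)
    then show "eventually (\<lambda>n. charf (y n) i = charf x i) sequentially"
      using eventually_sequentially by blast
  qed
  then have "limitin (product_topology (\<lambda>i. euclidean) UNIV) (\<lambda>n. charf (y n)) (charf x) sequentially"
    by (simp add: limitin_componentwise)
  then have "(\<lambda>n. charf (y n)) \<longlonglongrightarrow> charf x"
    by (simp add: euclidean_product_topology)
  then have "charf x \<in> charf ` C"
    using closed_sequentially[of "charf ` C" "\<lambda>n. charf (y n)" "charf x"] assms(1) y(1)
    unfolding closed_family_def by blast
  moreover have "inj charf"
    by (rule injI) (auto simp: charf_def fun_eq_iff)
  ultimately show ?thesis
    by (metis inj_image_mem_iff)
qed

text \<open>A set y homogeneous for the finite sets outside C is not of the first kind: it has an
  infinite subset in C, whose segments all lie in C. So every finite subset of y is in C, and y is a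
  limit of such sets.\<close>

lemma no_closed_hereditary_tall_subset:
  assumes pos: "\<And>F. \<forall>s\<in>F. finite s \<Longrightarrow> \<exists>y. y \<in> hom F \<and> y \<notin> I"
  shows "\<not> (\<exists>C. closed_family C \<and> hereditary C \<and> tall C \<and> C \<subseteq> I)"
proof
  assume "\<exists>C. closed_family C \<and> hereditary C \<and> tall C \<and> C \<subseteq> I"
  then obtain C where C: "closed_family C" "hereditary C" "tall C" "C \<subseteq> I"
    by blast
  let ?F = "{s. finite s \<and> s \<notin> C}"
  obtain y where y: "y \<in> hom ?F" "y \<notin> I"
    using pos[of ?F] by blast
  then have "infinite y"
    by (simp add: hom_def)
  then obtain z where z: "z \<subseteq> y" "infinite z" "z \<in> C"
    using C(3) unfolding tall_def by blast
  have "s \<in> C" if "initial_seg s z" for s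
    using that C(2) z(3) unfolding hereditary_def initial_seg_def by (metis Int_lower1)
  then have "\<not> (\<exists>s\<in>?F. initial_seg s z)"
    by blast
  then have fin: "s \<in> C" if "s \<subseteq> y" "finite s" for s
    using y(1) z that unfolding hom_def by blast
  have "y \<in> C"
  proof (rule closed_family_approx[OF C(1)])
    fix n
    show "\<exists>y'\<in>C. \<forall>i<n. i \<in> y' \<longleftrightarrow> i \<in> y"
      by (rule bexI[of _ "y \<inter> {..<n}"]) (auto intro: fin)
  qed
  then show False
    using C(4) y(2) by blast
qed

section \<open>Analytic sets and definability of the ideal\<close>

lemma continuous_fst: "continuous_on UNIV (\<lambda>p. fst p)"
  by (rule continuous_on_fst[OF continuous_on_id])

lemma continuous_fst_coordinate: "continuous_on UNIV (\<lambda>p. fst p i)"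
  by (rule continuous_on_product_then_coordinatewise[OF continuous_fst])

lemma continuous_snd: "continuous_on UNIV (\<lambda>p. snd p)"
  by (rule continuous_on_snd[OF continuous_on_id])

lemma continuous_snd_coordinate: "continuous_on UNIV (\<lambda>p. snd p i)"
  by (rule continuous_on_product_then_coordinatewise[OF continuous_snd])

lemma closed_vimage_discrete:
  fixes g :: "'a::topological_space \<Rightarrow> 'b::discrete_topology"
  assumes "continuous_on UNIV g"
  shows "closed {x. P (g x)}"
proof -
  have "closed (g -` {y. P y})"
    by (rule closed_vimage) (use assms in \<open>auto simp: closed_def open_discrete\<close>)
  then show ?thesis
    by (simp add: vimage_def)
qed

lemma Sigma11_closed:
  fixes A :: "'a::topological_space set"
  assumes "closed A"
  shows "Sigma11 A"
  unfolding Sigma11_def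
proof (intro exI conjI)
  show "closed (A \<times> (UNIV :: (nat \<Rightarrow> nat) set))"
    using assms by (simp add: closed_Times)
  show "A = fst ` (A \<times> (UNIV :: (nat \<Rightarrow> nat) set))"
    by simp
qed

lemma Sigma11_Collect_iff:
  fixes P :: "'a::topological_space \<Rightarrow> bool"
  shows "Sigma11 {x. P x} \<longleftrightarrow>
    (\<exists>C :: ('a \<times> (nat \<Rightarrow> nat)) set. closed C \<and> (\<forall>x. P x \<longleftrightarrow> (\<exists>r. (x, r) \<in> C)))"
proof -
  have "fst ` C = {x. \<exists>r. (x, r) \<in> C}" for C :: "('a \<times> (nat \<Rightarrow> nat)) set"
    by force
  then show ?thesis
    by (simp add: Sigma11_def set_eq_iff)
qed

text \<open>The new witness stores n at coordinate 0 and a witness for P n after it.\<close>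

lemma Sigma11_ex:
  fixes P :: "nat \<Rightarrow> 'a::topological_space \<Rightarrow> bool"
  assumes "\<And>n. Sigma11 {x. P n x}"
  shows "Sigma11 {x. \<exists>n. P n x}"
proof -
  obtain C :: "nat \<Rightarrow> ('a \<times> (nat \<Rightarrow> nat)) set"
    where C: "\<And>n. closed (C n)" "\<And>n x. P n x \<longleftrightarrow> (\<exists>r. (x, r) \<in> C n)"
    using assms unfolding Sigma11_Collect_iff by metis
  define g where "g = (\<lambda>p :: 'a \<times> (nat \<Rightarrow> nat). (fst p, \<lambda>j. snd p (Suc j)))"
  \<comment> \<open>An intersection of implications over n, in place of a union, keeps D
    closed.\<close>
  define D where "D = (\<Inter>n. {p :: 'a \<times> (nat \<Rightarrow> nat). snd p 0 \<noteq> n} \<union> g -` C n)"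
  have "continuous_on UNIV g"
    unfolding g_def
    by (intro continuous_on_Pair continuous_on_coordinatewise_then_product
        continuous_fst continuous_snd_coordinate)
  then have "closed (g -` C n)" for n
    using C(1) by (intro closed_vimage)
  moreover have "closed {p :: 'a \<times> (nat \<Rightarrow> nat). snd p 0 \<noteq> n}" for n
    by (rule closed_vimage_discrete[OF continuous_snd_coordinate])
  ultimately have "closed D"
    unfolding D_def by (intro closed_INT ballI closed_Un)
  moreover have "(\<exists>n. P n x) \<longleftrightarrow> (\<exists>r. (x, r) \<in> D)" for x
  proof
    assume "\<exists>n. P n x"
    then obtain n r where "(x, r) \<in> C n"
      using C(2) by blast
    then have "(x, case_nat n r) \<in> D"
      by (auto simp: D_def g_def)
    then show "\<exists>r. (x, r) \<in> D"
      by blast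
  next
    assume "\<exists>r. (x, r) \<in> D"
    then obtain r where "(x, r) \<in> D"
      by blast
    then have "(x, \<lambda>j. r (Suc j)) \<in> C (r 0)"
      by (auto simp: D_def g_def)
    then show "\<exists>n. P n x"
      using C(2) by blast
  qed
  ultimately show ?thesis
    unfolding Sigma11_Collect_iff by blast
qed

text \<open>Witnesses for all n are stored as the columns of one real, addressed by
  \<open>prod_encode\<close>.\<close>

lemma Sigma11_all:
  fixes P :: "nat \<Rightarrow> 'a::topological_space \<Rightarrow> bool"
  assumes "\<And>n. Sigma11 {x. P n x}"
  shows "Sigma11 {x. \<forall>n. P n x}"
proof -
  obtain C :: "nat \<Rightarrow> ('a \<times> (nat \<Rightarrow> nat)) set"
    where C: "\<And>n. closed (C n)" "\<And>n x. P n x \<longleftrightarrow> (\<exists>r. (x, r) \<in> C n)"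
    using assms unfolding Sigma11_Collect_iff by metis
  define g where "g = (\<lambda>n. \<lambda>p :: 'a \<times> (nat \<Rightarrow> nat). (fst p, \<lambda>j. snd p (prod_encode (n, j))))"
  define D where "D = (\<Inter>n. g n -` C n)"
  have "continuous_on UNIV (g n)" for n
    unfolding g_def
    by (intro continuous_on_Pair continuous_on_coordinatewise_then_product
        continuous_fst continuous_snd_coordinate)
  then have "closed D"
    unfolding D_def using C(1) by (intro closed_INT ballI closed_vimage)
  moreover have "(\<forall>n. P n x) \<longleftrightarrow> (\<exists>r. (x, r) \<in> D)" for x
  proof
    assume "\<forall>n. P n x"
    then have "\<forall>n. \<exists>r. (x, r) \<in> C n"
      using C(2) by blast
    then obtain r where "\<forall>n. (x, r n) \<in> C n"
      by (rule choice[THEN exE])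
    then have "(x, \<lambda>m. case prod_decode m of (n, j) \<Rightarrow> r n j) \<in> D"
      by (auto simp: D_def g_def)
    then show "\<exists>r. (x, r) \<in> D"
      by blast
  next
    assume "\<exists>r. (x, r) \<in> D"
    then show "\<forall>n. P n x"
      using C(2) by (auto simp: D_def g_def)
  qed
  ultimately show ?thesis
    unfolding Sigma11_Collect_iff by blast
qed

text \<open>Columns 0 and 1 of one real store h and the witness that belongs to it.\<close>

lemma Sigma11_ex_fun:
  fixes P :: "'a::topological_space \<Rightarrow> (nat \<Rightarrow> nat) \<Rightarrow> bool"
  assumes "Sigma11 {p. P (fst p) (snd p)}"
  shows "Sigma11 {x. \<exists>h. P x h}"
proof -
  obtain C :: "(('a \<times> (nat \<Rightarrow> nat)) \<times> (nat \<Rightarrow> nat)) set"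
    where C: "closed C" "\<And>x h. P x h \<longleftrightarrow> (\<exists>r. ((x, h), r) \<in> C)"
    using assms unfolding Sigma11_Collect_iff by auto
  define g where "g = (\<lambda>p :: 'a \<times> (nat \<Rightarrow> nat).
    ((fst p, \<lambda>j. snd p (prod_encode (0, j))), \<lambda>j. snd p (prod_encode (1, j))))"
  have "continuous_on UNIV g"
    unfolding g_def
    by (intro continuous_on_Pair continuous_on_coordinatewise_then_product
        continuous_fst continuous_snd_coordinate)
  then have "closed (g -` C)"
    using C(1) by (intro closed_vimage)
  moreover have "(\<exists>h. P x h) \<longleftrightarrow> (\<exists>r. (x, r) \<in> g -` C)" for x
  proof
    assume "\<exists>h. P x h"
    then obtain h r where "((x, h), r) \<in> C"
      using C(2) by blast
    then have "(x, \<lambda>m. case prod_decode m of (n, j) \<Rightarrow> if n = 0 then h j else r j) \<in> g -` C"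
      by (simp add: g_def)
    then show "\<exists>r. (x, r) \<in> g -` C"
      by blast
  next
    assume "\<exists>r. (x, r) \<in> g -` C"
    then show "\<exists>h. P x h"
      using C(2) by (auto simp: g_def)
  qed
  ultimately show ?thesis
    unfolding Sigma11_Collect_iff by blast
qed

lemma Sigma11_vimage:
  fixes g :: "'a::topological_space \<Rightarrow> 'b::topological_space"
  assumes "Sigma11 {y. P y}" "continuous_on UNIV g"
  shows "Sigma11 {x. P (g x)}"
proof -
  obtain C :: "('b \<times> (nat \<Rightarrow> nat)) set"
    where C: "closed C" "\<And>y. P y \<longleftrightarrow> (\<exists>r. (y, r) \<in> C)"
    using assms(1) unfolding Sigma11_Collect_iff by auto
  define G where "G = (\<lambda>p :: 'a \<times> (nat \<Rightarrow> nat). (g (fst p), snd p))"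
  have "continuous_on UNIV (\<lambda>p :: 'a \<times> (nat \<Rightarrow> nat). g (fst p))"
    by (rule continuous_on_compose2[OF assms(2) continuous_fst]) simp
  then have "continuous_on UNIV G"
    unfolding G_def by (intro continuous_on_Pair continuous_snd)
  then have "closed (G -` C)"
    using C(1) by (intro closed_vimage)
  moreover have "P (g x) \<longleftrightarrow> (\<exists>r. (x, r) \<in> G -` C)" for x
    using C(2) by (simp add: G_def)
  ultimately show ?thesis
    unfolding Sigma11_Collect_iff by blast
qed

section \<open>Calculus of Delta-1-1 and Pi-1-1 predicates\<close>

definition delta11 :: "('a::topological_space \<Rightarrow> bool) \<Rightarrow> bool" where
  "delta11 P \<longleftrightarrow> Sigma11 {x. P x} \<and> Sigma11 {x. \<not> P x}"

lemma delta11_discrete: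
  fixes g :: "'a::topological_space \<Rightarrow> 'b::discrete_topology"
  assumes "continuous_on UNIV g"
  shows "delta11 (\<lambda>x. P (g x))"
  unfolding delta11_def by (intro conjI Sigma11_closed closed_vimage_discrete assms)

lemma delta11_vimage:
  assumes "delta11 P" "continuous_on UNIV g"
  shows "delta11 (\<lambda>x. P (g x))"
  using Sigma11_vimage[of P g] Sigma11_vimage[of "\<lambda>y. \<not> P y" g] assms
  by (simp add: delta11_def)

lemma delta11_const: "delta11 (\<lambda>x. c)"
  unfolding delta11_def by (intro conjI Sigma11_closed) (cases c; simp)+

lemma delta11_not: "delta11 P \<Longrightarrow> delta11 (\<lambda>x. \<not> P x)"
  by (simp add: delta11_def)

lemma delta11_all:
  assumes "\<And>n::nat. delta11 (P n)"
  shows "delta11 (\<lambda>x. \<forall>n. P n x)"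
  using Sigma11_all[of P] Sigma11_ex[of "\<lambda>n x. \<not> P n x"] assms by (simp add: delta11_def)

lemma delta11_conj:
  assumes "delta11 P" "delta11 Q"
  shows "delta11 (\<lambda>x. P x \<and> Q x)"
proof -
  \<comment> \<open>The conjunction is treated as a countable one, with P at index 0 and Q at every
    other index.\<close>
  have "delta11 (\<lambda>x. \<forall>n::nat. (if n = 0 then P else Q) x)"
    using assms by (intro delta11_all) simp
  moreover have "(\<forall>n::nat. (if n = 0 then P else Q) x) \<longleftrightarrow> P x \<and> Q x" for x
    by (metis zero_neq_one)
  ultimately show ?thesis
    by simp
qed

lemma delta11_imp:
  assumes "delta11 P" "delta11 Q"
  shows "delta11 (\<lambda>x. P x \<longrightarrow> Q x)"
proof -
  have "delta11 (\<lambda>x. \<not> (P x \<and> \<not> Q x))"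
    by (intro delta11_not delta11_conj assms)
  then show ?thesis
    by simp
qed

lemma delta11_disj:
  assumes "delta11 P" "delta11 Q"
  shows "delta11 (\<lambda>x. P x \<or> Q x)"
proof -
  have "delta11 (\<lambda>x. \<not> P x \<longrightarrow> Q x)"
    by (intro delta11_not delta11_imp assms)
  then show ?thesis
    by (simp add: disj_imp)
qed

lemma delta11_iff:
  assumes "delta11 P" "delta11 Q"
  shows "delta11 (\<lambda>x. P x \<longleftrightarrow> Q x)"
  unfolding iff_conv_conj_imp by (intro delta11_conj delta11_imp assms)

lemma delta11_ex:
  assumes "\<And>n::nat. delta11 (P n)"
  shows "delta11 (\<lambda>x. \<exists>n. P n x)"
proof -
  have "delta11 (\<lambda>x. \<not> (\<forall>n. \<not> P n x))"
    by (intro delta11_not delta11_all assms)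
  then show ?thesis
    by simp
qed

definition pi11 :: "('a::topological_space \<Rightarrow> bool) \<Rightarrow> bool" where
  "pi11 P \<longleftrightarrow> Sigma11 {x. \<not> P x}"

lemma pi11_delta11: "delta11 P \<Longrightarrow> pi11 P"
  by (simp add: delta11_def pi11_def)

lemma pi11_all:
  assumes "\<And>n::nat. pi11 (P n)"
  shows "pi11 (\<lambda>x. \<forall>n. P n x)"
  using Sigma11_ex[of "\<lambda>n x. \<not> P n x"] assms by (simp add: pi11_def)

lemma pi11_conj:
  assumes "pi11 P" "pi11 Q"
  shows "pi11 (\<lambda>x. P x \<and> Q x)"
proof -
  have "pi11 (\<lambda>x. \<forall>n::nat. (if n = 0 then P else Q) x)"
    using assms by (intro pi11_all) simp
  moreover have "(\<forall>n::nat. (if n = 0 then P else Q) x) \<longleftrightarrow> P x \<and> Q x" for x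
    by (metis zero_neq_one)
  ultimately show ?thesis
    by simp
qed

text \<open>The negation is the intersection of P with the complement of Q, so P enters as a
  Sigma-1-1 set.\<close>

lemma pi11_imp:
  assumes "delta11 P" "pi11 Q"
  shows "pi11 (\<lambda>x. P x \<longrightarrow> Q x)"
proof -
  have "Sigma11 {x. \<forall>n::nat. (if n = 0 then P x else \<not> Q x)}"
  proof (rule Sigma11_all)
    show "Sigma11 {x. if n = 0 then P x else \<not> Q x}" for n :: nat
      using assms by (cases "n = 0") (simp_all add: delta11_def pi11_def)
  qed
  moreover have "(\<forall>n::nat. (if n = 0 then P x else \<not> Q x)) \<longleftrightarrow> \<not> (P x \<longrightarrow> Q x)" for x
    by (metis zero_neq_one)
  ultimately show ?thesis
    by (simp add: pi11_def)
qed

lemma pi11_all_fun: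
  assumes "pi11 (\<lambda>p. P (fst p) (snd p))"
  shows "pi11 (\<lambda>x. \<forall>h :: nat \<Rightarrow> nat. P x h)"
  using Sigma11_ex_fun[of "\<lambda>x h. \<not> P x h"] assms by (simp add: pi11_def)

section \<open>Membership in \<open>homs\<close> through number quantifiers\<close>

lemma branch_eq_iff:
  "branch f m = c \<longleftrightarrow> (\<forall>j. j \<in> set_decode c \<longleftrightarrow> j = m \<or> j \<in> f \<and> j < m)"
proof -
  have fin: "finite (insert m (f \<inter> {..<m}))"
    by simp
  have "branch f m = c \<longleftrightarrow> set_decode c = insert m (f \<inter> {..<m})"
    unfolding branch_def using set_encode_inverse[OF fin] set_decode_inverse[of c] by metis
  then show ?thesis
    by (auto simp: set_eq_iff)
qed

text \<open>Segments of a finite set are finite, so the quantifier over r becomes one over codes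
  e.\<close>

lemma bar_family_iff:
  "set_decode c \<in> bar (family f) \<longleftrightarrow>
    (\<exists>d. d \<in> f \<and> set_decode d \<subseteq> set_decode c) \<and>
    (\<forall>e. iseg (set_decode e) (set_decode c) \<and> e \<noteq> c \<longrightarrow>
      (\<forall>d. d \<in> f \<longrightarrow> \<not> set_decode d \<subseteq> set_decode e))"
proof -
  have inj: "set_decode e = set_decode c \<longleftrightarrow> e = c" for e c
    by (metis set_decode_inverse)
  have "\<exists>e. r = set_decode e" if "iseg r (set_decode c)" for r
    using that set_encode_inverse[of r] finite_subset[of r "set_decode c"]
    by (metis finite_set_decode iseg_def)
  then have "(\<forall>r. iseg r (set_decode c) \<and> r \<noteq> set_decode c \<longrightarrow> (\<forall>s\<in>family f. \<not> s \<subseteq> r)) \<longleftrightarrow>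
      (\<forall>e. iseg (set_decode e) (set_decode c) \<and> e \<noteq> c \<longrightarrow> (\<forall>s\<in>family f. \<not> s \<subseteq> set_decode e))"
    using inj by metis
  moreover have "(\<forall>s\<in>family f. Q s) \<longleftrightarrow> (\<forall>d. d \<in> f \<longrightarrow> Q (set_decode d))"
    "(\<exists>s\<in>family f. Q s) \<longleftrightarrow> (\<exists>d. d \<in> f \<and> Q (set_decode d))" for Q
    by (auto simp: family_def)
  ultimately show ?thesis
    unfolding bar_def by simp
qed

lemma good_family_iff:
  "good (family f) m (set_decode c) \<longleftrightarrow>
    (m = 0 \<longrightarrow> c \<notin> f) \<and> (m \<noteq> 0 \<longrightarrow> set_decode c \<in> bar (family f) \<longrightarrow>
      (\<exists>d. d \<in> f \<and> iseg (set_decode d) (set_decode c)))"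
proof -
  have "set_decode c \<in> family f \<longleftrightarrow> c \<in> f"
    unfolding family_def by (metis (no_types, lifting) imageE imageI set_decode_inverse)
  then show ?thesis
    by (auto simp: good_def family_def)
qed

text \<open>Values of k enter through equations with a fixed argument and a fixed value, the form in
  which \<open>delta11_homs\<close> assumes k to be definable.\<close>

lemma mem_homs_iff:
  "k \<in> homs A F \<longleftrightarrow> (\<exists>m. k 0 = m \<and> m \<le> 1 \<and>
     (\<forall>n a b. k (Suc n) = a \<and> k (Suc (Suc n)) = b \<longrightarrow> a < b) \<and>
     (\<forall>n a. k (Suc n) = a \<longrightarrow> a \<in> A) \<and>
     (\<forall>c. (\<forall>a. a \<in> set_decode c \<longrightarrow> (\<exists>n. k (Suc n) = a)) \<longrightarrow> good F m (set_decode c)))"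
proof -
  have "(\<forall>t. finite t \<longrightarrow> t \<subseteq> range (k \<circ> Suc) \<longrightarrow> good F (k 0) t) \<longleftrightarrow>
      (\<forall>c. set_decode c \<subseteq> range (k \<circ> Suc) \<longrightarrow> good F (k 0) (set_decode c))"
    by (metis finite_set_decode set_encode_inverse)
  moreover have "set_decode c \<subseteq> range (k \<circ> Suc) \<longleftrightarrow>
      (\<forall>a. a \<in> set_decode c \<longrightarrow> (\<exists>n. k (Suc n) = a))" for c
    by (auto simp: subset_iff image_iff)
  ultimately show ?thesis
    by (simp add: homs_def strict_mono_Suc_iff image_subset_iff)
qed

lemma delta11_homs:
  assumes f: "\<And>n. delta11 (\<lambda>x. n \<in> f x)" and g: "\<And>n m. delta11 (\<lambda>x. g x n = m)"
    and k: "\<And>n m. delta11 (\<lambda>x. k x n = m)"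
  shows "delta11 (\<lambda>x. k x \<in> homs ((g x \<circ> Suc) ` range (branch (f x))) (family (f x)))"
proof -
  have "delta11 (\<lambda>x. branch (f x) m = c)" for m c
    unfolding branch_eq_iff by (intro delta11_all delta11_iff delta11_disj delta11_conj delta11_const f)
  \<comment> \<open>Naming the node b lets \<open>g x\<close> be evaluated at a fixed
    argument.\<close>
  then have "delta11 (\<lambda>x. \<exists>m b. branch (f x) m = b \<and> g x (Suc b) = a)" for a
    by (intro delta11_ex delta11_conj g)
  moreover have "a \<in> (g x \<circ> Suc) ` range (branch (f x)) \<longleftrightarrow>
      (\<exists>m b. branch (f x) m = b \<and> g x (Suc b) = a)" for a x
    by auto
  ultimately have A: "delta11 (\<lambda>x. a \<in> (g x \<circ> Suc) ` range (branch (f x)))" for a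
    by simp
  have bar: "delta11 (\<lambda>x. set_decode c \<in> bar (family (f x)))" for c
    unfolding bar_family_iff
    by (intro delta11_all delta11_ex delta11_imp delta11_not delta11_conj delta11_const f)
  have good: "delta11 (\<lambda>x. good (family (f x)) m (set_decode c))" for m c
    unfolding good_family_iff
    by (intro delta11_ex delta11_imp delta11_not delta11_conj delta11_const f bar)
  show ?thesis
    unfolding mem_homs_iff
    by (intro delta11_all delta11_ex delta11_imp delta11_conj delta11_const k A good)
qed

lemma delta11_lexless:
  assumes k: "\<And>n m. delta11 (\<lambda>x. k x n = m)" and k': "\<And>n m. delta11 (\<lambda>x. k' x n = m)"
  shows "delta11 (\<lambda>x. lexless (k x) (k' x))"
proof -
  have "lexless h h' \<longleftrightarrow> (\<exists>n. (\<forall>i. i < n \<longrightarrow> (\<exists>a. h i = a \<and> h' i = a)) \<and>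
      (\<exists>a b. h n = a \<and> h' n = b \<and> a < b))" for h h'
    unfolding lexless_def by metis
  then show ?thesis
    by (simp only:)
      (intro delta11_all delta11_ex delta11_imp delta11_conj delta11_const k k')
qed

text \<open>Membership and comparison are Delta-1-1; the only quantifier over reals is the universal
  one over competitors.\<close>

lemma pi11_is_lexmin_homs:
  fixes f :: "'a::topological_space \<Rightarrow> nat set"
  assumes f: "\<And>n. delta11 (\<lambda>x. n \<in> f x)" and g: "\<And>n m. delta11 (\<lambda>x. g x n = m)"
    and k: "\<And>n m. delta11 (\<lambda>x. k x n = m)"
  shows "pi11 (\<lambda>x. is_lexmin (homs ((g x \<circ> Suc) ` range (branch (f x))) (family (f x))) (k x))"
proof -
  have fst: "continuous_on UNIV (fst :: 'a \<times> (nat \<Rightarrow> nat) \<Rightarrow> 'a)"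
    by (rule continuous_fst)
  have snd: "delta11 (\<lambda>p :: 'a \<times> (nat \<Rightarrow> nat). snd p n = m)" for n m
    by (rule delta11_discrete[OF continuous_snd_coordinate])
  show ?thesis
    unfolding is_lexmin_def
    by (intro pi11_conj pi11_all_fun pi11_imp pi11_delta11 delta11_not delta11_homs delta11_lexless
        f g k snd delta11_vimage[OF f fst] delta11_vimage[OF g fst] delta11_vimage[OF k fst])
qed

text \<open>A real r codes a finite sequence of generators: its column 0 contains the length, the odd
columns the generators and the even columns the branches along which they were chosen.\<close>

definition len :: "(nat \<Rightarrow> nat) \<Rightarrow> nat" where
  "len r = r (prod_encode (0, 0))"

definition gens :: "(nat \<Rightarrow> nat) \<Rightarrow> nat \<Rightarrow> nat \<Rightarrow> nat" where
  "gens r i n = r (prod_encode (2 * i + 1, n))"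

definition branches :: "(nat \<Rightarrow> nat) \<Rightarrow> nat \<Rightarrow> nat set" where
  "branches r i = {n. r (prod_encode (2 * i + 2, n)) = 0}"

text \<open>Naming the length L makes \<open>i < L\<close> a constant predicate and the equation for
  the length a Delta-1-1 premise, as \<open>pi11_imp\<close> requires.\<close>

definition codes_generators :: "(nat \<Rightarrow> nat) \<Rightarrow> bool" where
  "codes_generators r \<longleftrightarrow> (\<forall>n. gens r 0 n = n) \<and>
    (\<forall>L. len r = L \<longrightarrow> (\<forall>i. i < L \<longrightarrow>
      is_lexmin (homs ((gens r i \<circ> Suc) ` range (branch (branches r i))) (family (branches r i)))
        (gens r (Suc i))))"

text \<open>Lexicographic minima are unique, so each step of the code reproduces \<open>gen\<close>,
  with the i-th branch put in front of the list.\<close>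

lemma codes_generators_sound:
  assumes "codes_generators r" "i \<le> len r"
  shows "\<exists>c. gens r i = gen c"
  using assms(2)
proof (induction i)
  case 0
  have "gens r 0 = gen []"
    using assms(1) by (auto simp: codes_generators_def)
  then show ?case
    by blast
next
  case (Suc i)
  then obtain c where c: "gens r i = gen c"
    by auto
  have "is_lexmin (homs ((gen c \<circ> Suc) ` range (branch (branches r i))) (family (branches r i)))
      (gens r (Suc i))"
    using assms(1) Suc.prems c unfolding codes_generators_def by (metis Suc_le_lessD)
  then have "gens r (Suc i) = gen (branches r i # c)"
    using is_lexmin_gen is_lexmin_unique by blast
  then show ?case
    by blast
qed

lemma codes_generators_complete: "\<exists>r. codes_generators r \<and> gens r (len r) = gen c"
proof -
  \<comment> \<open>The list is read from its end: generator i, in column 2i+1, belongs to the last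
    i entries, and branch i, in column 2i+2, is the entry just before them. The value 0 marks
    membership, as in \<open>branches\<close>.\<close>
  define r where "r m = (case prod_decode m of (j, n) \<Rightarrow>
     if j = 0 then length c
     else if odd j then gen (drop (length c - j div 2) c) n
     else if n \<in> c ! (length c - j div 2) then 0 else 1)" for m
  have len: "len r = length c"
    by (simp add: len_def r_def)
  have gens: "gens r i = gen (drop (length c - i) c)" for i
    by (simp add: gens_def r_def fun_eq_iff)
  have branches: "branches r i = c ! (length c - Suc i)" for i
    by (simp add: branches_def r_def)
  have "is_lexmin (homs ((gens r i \<circ> Suc) ` range (branch (branches r i))) (family (branches r i)))
      (gens r (Suc i))" if i: "i < length c" for i
  proof -
    have "drop (length c - Suc i) c = branches r i # drop (length c - i) c"
      using i Cons_nth_drop_Suc[of "length c - Suc i" c] by (simp add: branches Suc_diff_Suc)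
    then show ?thesis
      unfolding gens using is_lexmin_gen by metis
  qed
  moreover have "gens r 0 n = n" for n
    by (simp add: gens)
  ultimately have "codes_generators r"
    by (simp add: codes_generators_def len)
  then show ?thesis
    using len gens by auto
qed

lemma Pi12_family_gen_ideal: "Pi12_family gen_ideal"
proof -
  let ?B = "\<lambda>p :: (nat \<Rightarrow> bool) \<times> (nat \<Rightarrow> nat). codes_generators (snd p) \<and>
    (\<forall>L. len (snd p) = L \<longrightarrow> (\<forall>n a. gens (snd p) L (Suc n) = a \<longrightarrow> fst p a))"
  have atom: "delta11 (\<lambda>p :: (nat \<Rightarrow> bool) \<times> (nat \<Rightarrow> nat). snd p n = m)" for n m
    by (rule delta11_discrete[OF continuous_snd_coordinate])
  have atom': "delta11 (\<lambda>p :: (nat \<Rightarrow> bool) \<times> (nat \<Rightarrow> nat). fst p n)" for n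
    by (rule delta11_discrete[OF continuous_fst_coordinate])
  have len: "delta11 (\<lambda>p :: (nat \<Rightarrow> bool) \<times> (nat \<Rightarrow> nat). len (snd p) = L)" for L
    unfolding len_def by (rule atom)
  have gens: "delta11 (\<lambda>p :: (nat \<Rightarrow> bool) \<times> (nat \<Rightarrow> nat). gens (snd p) i n = m)" for i n m
    unfolding gens_def by (rule atom)
  have branches: "delta11 (\<lambda>p :: (nat \<Rightarrow> bool) \<times> (nat \<Rightarrow> nat). n \<in> branches (snd p) i)" for i n
    unfolding branches_def mem_Collect_eq by (rule atom)
  have "pi11 ?B"
    unfolding codes_generators_def
    by (intro pi11_conj pi11_all pi11_imp pi11_is_lexmin_homs len gens branches delta11_const)
      (intro pi11_delta11 delta11_all delta11_imp len gens atom')+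
  then have "Pi11 {p. ?B p}"
    by (simp add: Pi11_def pi11_def Collect_neg_eq[symmetric])
  moreover have "- (charf ` gen_ideal) = fst ` {p. ?B p}"
  proof (rule set_eqI)
    fix X :: "nat \<Rightarrow> bool"
    have "X \<in> charf ` gen_ideal \<longleftrightarrow> Collect X \<in> gen_ideal"
    proof
      assume "Collect X \<in> gen_ideal"
      moreover have "X = charf (Collect X)"
        by (simp add: charf_def)
      ultimately show "X \<in> charf ` gen_ideal"
        by blast
    qed (auto simp: charf_def)
    then have "X \<in> - (charf ` gen_ideal) \<longleftrightarrow> (\<exists>c. \<forall>n. X (gen c (Suc n)))"
      by (simp add: gen_ideal_def genset_def image_subset_iff)
    \<comment> \<open>The quantifier over lists of sets becomes one over a single real, so the
      complement of the ideal is a projection of a Pi-1-1 set.\<close>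
    also have "\<dots> \<longleftrightarrow> (\<exists>r. codes_generators r \<and> (\<forall>n. X (gens r (len r) (Suc n))))"
      using codes_generators_sound codes_generators_complete by (metis order_refl)
    also have "\<dots> \<longleftrightarrow> X \<in> fst ` {p. ?B p}"
      by (force simp: image_iff)
    finally show "X \<in> - (charf ` gen_ideal) \<longleftrightarrow> X \<in> fst ` {p. ?B p}" .
  qed
  ultimately show ?thesis
    unfolding Pi12_family_def Pi12_def Sigma12_def by blast
qed

theorem mainTheorem4:
  shows "\<exists>I :: nat set set. is_ideal I \<and> tall I \<and> Pi12_family I \<and>
    (\<forall>x. x \<notin> I \<longrightarrow> (\<forall>F. (\<forall>s\<in>F. finite s) \<longrightarrow>
        (\<exists>y. y \<subseteq> x \<and> y \<in> hom F \<and> y \<notin> I))) \<and>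
    \<not> (\<exists>C. closed_family C \<and> hereditary C \<and> tall C \<and> C \<subseteq> I)"
proof (intro exI[of _ gen_ideal] conjI allI impI)
  show "\<not> (\<exists>C. closed_family C \<and> hereditary C \<and> tall C \<and> C \<subseteq> gen_ideal)"
  proof (rule no_closed_hereditary_tall_subset)
    fix F :: "nat set set"
    assume "\<forall>s\<in>F. finite s"
    moreover have "UNIV \<notin> gen_ideal"
      by (auto simp: gen_ideal_def)
    ultimately show "\<exists>y. y \<in> hom F \<and> y \<notin> gen_ideal"
      using ex_positive_hom by blast
  qed
qed (use is_ideal_gen_ideal tall_gen_ideal Pi12_family_gen_ideal ex_positive_hom in blast)+

end
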